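(* (1) If $M:\langle\Gamma\vdash U\rangle$ is derivable then $M\in\mathcal M$, $\Gamma$ is a type environment and $U\in\mathbb U$ (the typing relation is well defined on $\mathcal M\times Env\times\mathbb U$). (2) If $M:\langle\Gamma\vdash U\rangle$ then $\Gamma$ is OK and $d(\Gamma)\succeq d(U)=d(M)$. (3) If $M:\langle\Gamma\vdash U\rangle$ and $d(U)\succeq K$ then $M^{-K}:\langle\Gamma^{-K}\vdash U^{-K}\rangle$.
   Context: Indexes: finite sequences of natural numbers ($\mathcal L_{\mathbb N}$), $\oslash$ empty, $i::L$ prepending $i$, $L::K$ concatenation, $L_1\preceq L_2$ (also $L_2\succeq L_1$) iff $L_2=L_1::L_3$ for some $L_3$. Terms: over a countably infinite set $\mathcal V$, terms $\mathcal M$, free indexed variables $\mathrm{fv}$, degree $d$, joinability $\diamond$ defined simultaneously: $x^L\in\mathcal M$ ($\mathrm{fv}=\{x^L\}$, $d=L$); $MN\in\mathcal M$ when $d(M)\preceq d(N)$, $M\diamond N$ ($\mathrm{fv}$ union, $d(MN)=d(M)$); $\lambda x^L.M\in\mathcal M$ when $L\succeq d(M)$ ($\mathrm{fv}(M)\setminus\{x^L\}$, $d=d(M)$). $M\diamond N$ iff $x^L\in\mathrm{fv}(M)$, $x^K\in\mathrm{fv}(N)$ imply $L=K$. Terms modulo $\alpha$. Lifting $(x^L)^{+i}=x^{i::L}$, $(M_1M_2)^{+i}=M_1^{+i}M_2^{+i}$, $(\lambda x^L.M)^{+i}=\lambda x^{i::L}.M^{+i}$. If $d(M)=i::L$, $M^{-i}$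 is defined by $(x^{i::K})^{-i}=x^K$, $(M_1M_2)^{-i}=M_1^{-i}M_2^{-i}$, $(\lambda x^{i::K}.M)^{-i}=\lambda x^K.M^{-i}$; $M^{-\oslash}=M$ and, if $d(M)\succeq i::L$, $M^{-(i::L)}=(M^{-i})^{-L}$. Types: atomic types $\mathcal A$, expansion variables $\overline e_0,\overline e_1,\dots$; $\mathbb T\subseteq\mathbb U$ with degree: $a\in\mathbb T$ ($d=\oslash$); $U\to T\in\mathbb T$ for $U\in\mathbb U,T\in\mathbb T$ ($d=\oslash$); $\omega^L\in\mathbb U$ ($d=L$); $U_1\sqcap U_2$ if $d(U_1)=d(U_2)$ (same degree); $\overline e_iU$ ($d=i::d(U)$); modulo $\sqcap$ commutative, associative, idempotent, $\overline e_i(U_1\sqcap U_2)=\overline e_iU_1\sqcap\overline e_iU_2$, $\omega^L\sqcap U=U$ ($d(U)=L$), $\overline e_i\omega^K=\omega^{i::K}$. For $d(U)\succeq L$: $U^{-\oslash}=U$, $(U_1\sqcap U_2)^{-i::K}=U_1^{-i::K}\sqcap U_2^{-i::K}$, $(\overline e_iU)^{-i::K}=U^{-K}$. Environments ($Env$): finite sets $\{x_1^{L_1}:U_1,\dots,x_n^{L_n}:U_n\}$, $U_i\in\mathbb U$, giving each $x^L$ at most one type; $\Gamma,\Delta$ disjoint union; $env^\omega_M$ assigns $\omega^L$ to each $x^L\in\mathrm{fv}(M)$; $\Gamma$ is OK iff $d(U)=L$ for every $x^L:U\in\Gamma$; $\Gamma_1\sqcap\Gamma_2$ intersects types of common variables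 (of equal degree), keeps others; $\overline e_j\Gamma$ replaces $x^L:U$ by $x^{j::L}:\overline e_jU$; $\Gamma_1\diamond\Gamma_2$ iff $x^L\in\mathrm{dom}\,\Gamma_1$, $x^K\in\mathrm{dom}\,\Gamma_2$ imply $L=K$; $d(\Gamma)\succeq L$ iff for all $x_i^{L_i}:U_i\in\Gamma$, $d(U_i)\succeq L$ and $L_i\succeq L$; then $L_i=L::L_i'$ and $\Gamma^{-L}=\{x_i^{L_i'}:U_i^{-L}\}$. Subtyping $\sqsubseteq$: least relation on types, environments and typings closed under reflexivity, transitivity, $U_1\sqcap U_2\sqsubseteq U_1$ ($d(U_1)=d(U_2)$), $U_1\sqcap U_2\sqsubseteq V_1\sqcap V_2$ if $U_i\sqsubseteq V_i$, $U_1\to T_1\sqsubseteq U_2\to T_2$ if $U_2\sqsubseteq U_1$, $T_1\sqsubseteq T_2$, $\overline e_iU_1\sqsubseteq\overline e_iU_2$ if $U_1\sqsubseteq U_2$, $\Gamma,y^L:U_1\sqsubseteq\Gamma,y^L:U_2$ if $U_1\sqsubseteq U_2$, $\langle\Gamma_1\vdash U_1\rangle\sqsubseteq\langle\Gamma_2\vdash U_2\rangle$ if $U_1\sqsubseteq U_2$, $\Gamma_2\sqsubseteq\Gamma_1$. Typing rules (with $M$ ranging over terms, $T\in\mathbb T$, $U\in\mathbb U$): (ax) $x^\oslash:\langle(x^\oslash:T)\vdash T\rangle$; ($\omega$) $M:\langle env^\omega_M\vdash\omega^{d(M)}\rangle$; ($\to_I$) $M:\langle\Gamma,(x^L:U)\vdash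 T\rangle\Rightarrow\lambda x^L.M:\langle\Gamma\vdash U\to T\rangle$; ($\to'_I$) $M:\langle\Gamma\vdash T\rangle$, $x^L\notin\mathrm{dom}\,\Gamma\Rightarrow\lambda x^L.M:\langle\Gamma\vdash\omega^L\to T\rangle$; ($\to_E$) $M_1:\langle\Gamma_1\vdash U\to T\rangle$, $M_2:\langle\Gamma_2\vdash U\rangle$, $\Gamma_1\diamond\Gamma_2\Rightarrow M_1M_2:\langle\Gamma_1\sqcap\Gamma_2\vdash T\rangle$; ($\sqcap_I$) $M:\langle\Gamma\vdash U_1\rangle$, $M:\langle\Gamma\vdash U_2\rangle\Rightarrow M:\langle\Gamma\vdash U_1\sqcap U_2\rangle$; ($e$) $M:\langle\Gamma\vdash U\rangle\Rightarrow M^{+j}:\langle\overline e_j\Gamma\vdash\overline e_jU\rangle$; ($\sqsubseteq$) $M:\langle\Gamma\vdash U\rangle$, $\langle\Gamma\vdash U\rangle\sqsubseteq\langle\Gamma'\vdash U'\rangle\Rightarrow M:\langle\Gamma'\vdash U'\rangle$. *)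

theory Defs
  imports Main "HOL-Library.Sublist"
begin

text \<open>An index is a list of naturals; \<open>L1 \<preceq> L2\<close> is the library's \<open>prefix L1 L2\<close>.
  Variable names are naturals, and the indexed variable \<open>x\<close> with index \<open>L\<close> is the pair \<open>(x, L)\<close>.\<close>

type_synonym idx = "nat list"
type_synonym ivar = "nat \<times> idx"

subsection \<open>Terms modulo \<open>\<alpha>\<close>-conversion\<close>

text \<open>Preterms do not obey the degree and joinability conditions. They are first quotiented by
  \<open>\<alpha>\<close>-conversion; the set \<open>\<M>\<close> of terms is then carved out of the quotient.\<close>

datatype preterm = PVar ivar | PApp preterm preterm | PLam ivar preterm

primrec pfv :: "preterm \<Rightarrow> ivar set" where
  "pfv (PVar v) = {v}"
| "pfv (PApp M N) = pfv M \<union> pfv N"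
| "pfv (PLam v M) = pfv M - {v}"

primrec pdeg :: "preterm \<Rightarrow> idx" where
  "pdeg (PVar v) = snd v"
| "pdeg (PApp M N) = pdeg M"
| "pdeg (PLam v M) = pdeg M"

text \<open>All occurring variables, including binders.\<close>

primrec pvars :: "preterm \<Rightarrow> ivar set" where
  "pvars (PVar v) = {v}"
| "pvars (PApp M N) = pvars M \<union> pvars N"
| "pvars (PLam v M) = insert v (pvars M)"

text \<open>\<open>prename v w M\<close> replaces the free occurrences of \<open>v\<close> by \<open>w\<close>; it is only used for \<open>w\<close> not
  occurring in \<open>M\<close>, so that no capture can happen.\<close>

primrec prename :: "ivar \<Rightarrow> ivar \<Rightarrow> preterm \<Rightarrow> preterm" where
  "prename v w (PVar u) = PVar (if u = v then w else u)"
| "prename v w (PApp M N) = PApp (prename v w M) (prename v w N)"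
| "prename v w (PLam u M) = PLam u (if u = v then M else prename v w M)"

text \<open>In the renaming rule the new name \<open>y\<close> must not occur with any index whatsoever, for otherwise
  the joinability of subterms could be destroyed.\<close>

inductive alpha :: "preterm \<Rightarrow> preterm \<Rightarrow> bool" where
  alpha_refl: "alpha M M"
| alpha_sym: "alpha M N \<Longrightarrow> alpha N M"
| alpha_trans: "alpha M N \<Longrightarrow> alpha N P \<Longrightarrow> alpha M P"
| alpha_app: "alpha M M' \<Longrightarrow> alpha N N' \<Longrightarrow> alpha (PApp M N) (PApp M' N')"
| alpha_lam: "alpha M M' \<Longrightarrow> alpha (PLam v M) (PLam v M')"
| alpha_rename: "(\<forall>K. (y, K) \<notin> pvars M) \<Longrightarrow>
    alpha (PLam (x, L) M) (PLam (y, L) (prename (x, L) (y, L) M))"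

primrec plift :: "nat \<Rightarrow> preterm \<Rightarrow> preterm" where
  "plift i (PVar v) = PVar (fst v, i # snd v)"
| "plift i (PApp M N) = PApp (plift i M) (plift i N)"
| "plift i (PLam v M) = PLam (fst v, i # snd v) (plift i M)"

text \<open>\<open>M\<^sup>-\<^sup>i\<close> makes sense when all indices in \<open>M\<close>, also those of binders, start with \<open>i\<close>. For terms
  this follows from the degree of \<open>M\<close> starting with \<open>i\<close> (\<open>expanded_by_M\<close>).\<close>

primrec pexpanded_by :: "nat \<Rightarrow> preterm \<Rightarrow> bool" where
  "pexpanded_by i (PVar v) = prefix [i] (snd v)"
| "pexpanded_by i (PApp M N) = (pexpanded_by i M \<and> pexpanded_by i N)"
| "pexpanded_by i (PLam v M) = (prefix [i] (snd v) \<and> pexpanded_by i M)"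

primrec pdrop :: "preterm \<Rightarrow> preterm" where
  "pdrop (PVar v) = PVar (fst v, tl (snd v))"
| "pdrop (PApp M N) = PApp (pdrop M) (pdrop N)"
| "pdrop (PLam v M) = PLam (fst v, tl (snd v)) (pdrop M)"

text \<open>Outside its domain, the operation is made total by returning \<open>M\<close>.\<close>

definition pminus :: "nat \<Rightarrow> preterm \<Rightarrow> preterm" where
  "pminus i M = (if pexpanded_by i M then pdrop M else M)"

lemma finite_pfv: "finite (pfv M)"
  by (induction M) auto

lemma pfv_subset_pvars: "pfv M \<subseteq> pvars M"
  by (induction M) auto

lemma prename_pfv:
  "w \<notin> pvars M \<Longrightarrow> pfv (prename v w M) = (if v \<in> pfv M then insert w (pfv M - {v}) else pfv M)"
proof (induction M)
  case (PLam u M)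
  then show ?case using pfv_subset_pvars[of M] by (cases "u = v") auto
qed auto

lemma prename_pdeg: "snd v = snd w \<Longrightarrow> pdeg (prename v w M) = pdeg M"
  by (induction M) auto

lemma prename_plift:
  "plift i (prename v w M) = prename (fst v, i # snd v) (fst w, i # snd w) (plift i M)"
  by (induction M) (auto simp: prod_eq_iff)

lemma plift_pvars: "pvars (plift i M) = (\<lambda>v. (fst v, i # snd v)) ` pvars M"
  by (induction M) auto

lemma prename_pexpanded_by:
  "snd v = snd w \<Longrightarrow> pexpanded_by i (prename v w M) = pexpanded_by i M"
  by (induction M) auto

lemma prename_pdrop:
  "pexpanded_by i M \<Longrightarrow> prefix [i] (snd v) \<Longrightarrow>
   pdrop (prename v w M) = prename (fst v, tl (snd v)) (fst w, tl (snd w)) (pdrop M)"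
  by (induction M) (auto simp: prod_eq_iff prefix_def)

lemma pdrop_pvars: "pvars (pdrop M) = (\<lambda>v. (fst v, tl (snd v))) ` pvars M"
  by (induction M) auto

lemma alpha_pfv: "alpha M N \<Longrightarrow> pfv M = pfv N"
proof (induction rule: alpha.induct)
  case (alpha_rename y M x L)
  then show ?case using pfv_subset_pvars[of M] by (auto simp: prename_pfv)
qed auto

lemma alpha_pdeg: "alpha M N \<Longrightarrow> pdeg M = pdeg N"
  by (induction rule: alpha.induct) (auto simp: prename_pdeg)

lemma alpha_plift: "alpha M N \<Longrightarrow> alpha (plift i M) (plift i N)"
proof (induction rule: alpha.induct)
  case (alpha_rename y M x L)
  then show ?case
    using alpha.alpha_rename[of y "plift i M" x "i # L"]
    by (force simp: prename_plift plift_pvars)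
qed (auto intro: alpha.intros)

lemma alpha_pexpanded_by: "alpha M N \<Longrightarrow> pexpanded_by i M = pexpanded_by i N"
  by (induction rule: alpha.induct) (auto simp: prename_pexpanded_by)

lemma alpha_pdrop: "alpha M N \<Longrightarrow> pexpanded_by i M \<Longrightarrow> alpha (pdrop M) (pdrop N)"
proof (induction rule: alpha.induct)
  case (alpha_sym M N)
  then show ?case using alpha_pexpanded_by alpha.alpha_sym by blast
next
  case (alpha_trans M N P)
  then show ?case using alpha_pexpanded_by alpha.alpha_trans by blast
next
  case (alpha_rename y M x L)
  then show ?case
    using alpha.alpha_rename[of y "pdrop M" x "tl L"]
    by (force simp: prename_pdrop pdrop_pvars)
qed (auto intro: alpha.intros)

lemma alpha_pminus: "alpha M N \<Longrightarrow> alpha (pminus i M) (pminus i N)"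
  by (simp add: pminus_def alpha_pexpanded_by alpha_pdrop)

quotient_type trm = preterm / alpha
  by (intro equivpI reflpI sympI transpI) (auto intro: alpha.intros)

lift_definition Var :: "ivar \<Rightarrow> trm" is PVar .
lift_definition App :: "trm \<Rightarrow> trm \<Rightarrow> trm" is PApp by (rule alpha_app)
lift_definition Lam :: "ivar \<Rightarrow> trm \<Rightarrow> trm" is PLam by (rule alpha_lam)
lift_definition fv :: "trm \<Rightarrow> ivar set" is pfv by (rule alpha_pfv)
lift_definition deg :: "trm \<Rightarrow> idx" is pdeg by (rule alpha_pdeg)
lift_definition lift :: "nat \<Rightarrow> trm \<Rightarrow> trm" is plift by (rule alpha_plift)
lift_definition expanded_by :: "nat \<Rightarrow> trm \<Rightarrow> bool" is pexpanded_by by (rule alpha_pexpanded_by)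
lift_definition term_minus1 :: "nat \<Rightarrow> trm \<Rightarrow> trm" is pminus by (rule alpha_pminus)

definition joinable :: "trm \<Rightarrow> trm \<Rightarrow> bool" where
  "joinable M N \<longleftrightarrow> (\<forall>x L K. (x, L) \<in> fv M \<longrightarrow> (x, K) \<in> fv N \<longrightarrow> L = K)"

inductive_set \<M> :: "trm set" where
  M_Var: "Var (x, L) \<in> \<M>"
| M_App: "M \<in> \<M> \<Longrightarrow> N \<in> \<M> \<Longrightarrow> prefix (deg M) (deg N) \<Longrightarrow> joinable M N \<Longrightarrow> App M N \<in> \<M>"
| M_Lam: "M \<in> \<M> \<Longrightarrow> prefix (deg M) L \<Longrightarrow> Lam (x, L) M \<in> \<M>"

primrec term_minus :: "idx \<Rightarrow> trm \<Rightarrow> trm" where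
  "term_minus [] M = M"
| "term_minus (i # L) M = term_minus L (term_minus1 i M)"

lemma fv_simps [simp]:
  "fv (Var v) = {v}" "fv (App M N) = fv M \<union> fv N" "fv (Lam v M) = fv M - {v}"
  by (transfer; simp)+

lemma finite_fv: "finite (fv M)"
  by transfer (rule finite_pfv)

lemma deg_simps [simp]:
  "deg (Var (x, L)) = L" "deg (App M N) = deg M" "deg (Lam v M) = deg M"
  by (transfer; simp)+

lemma lift_simps [simp]:
  "lift i (Var (x, L)) = Var (x, i # L)"
  "lift i (App M N) = App (lift i M) (lift i N)"
  "lift i (Lam (x, L) M) = Lam (x, i # L) (lift i M)"
  by (transfer; simp add: alpha_refl)+

lemma expanded_by_simps [simp]:
  "expanded_by i (Var (x, L)) \<longleftrightarrow> prefix [i] L"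
  "expanded_by i (App M N) \<longleftrightarrow> expanded_by i M \<and> expanded_by i N"
  "expanded_by i (Lam (x, L) M) \<longleftrightarrow> prefix [i] L \<and> expanded_by i M"
  by (transfer; simp)+

lemma expanded_by_M: "M \<in> \<M> \<Longrightarrow> prefix [i] (deg M) \<Longrightarrow> expanded_by i M"
  by (induction rule: \<M>.induct) (use prefix_order.trans in \<open>auto; blast\<close>)+

lemma term_minus1_simps:
  "term_minus1 i (Var (x, i # K)) = Var (x, K)"
  "expanded_by i M \<Longrightarrow> expanded_by i N \<Longrightarrow> term_minus1 i (App M N) = App (term_minus1 i M) (term_minus1 i N)"
  "expanded_by i M \<Longrightarrow> term_minus1 i (Lam (x, i # K) M) = Lam (x, K) (term_minus1 i M)"
  by (transfer; simp add: pminus_def alpha_refl)+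

subsection \<open>Types modulo their equations\<close>

text \<open>The parameter \<open>'a\<close> is the set of atomic types. As for terms, the well-formedness conditions are
  imposed on the quotient.\<close>

datatype 'a pretype =
    PAtom 'a
  | PArr "'a pretype" "'a pretype"
  | POmega idx
  | PInter "'a pretype" "'a pretype"
  | PExp nat "'a pretype"

primrec ptdeg :: "'a pretype \<Rightarrow> idx" where
  "ptdeg (PAtom a) = []"
| "ptdeg (PArr U T) = []"
| "ptdeg (POmega L) = L"
| "ptdeg (PInter U V) = ptdeg U"
| "ptdeg (PExp i U) = i # ptdeg U"

inductive type_eq :: "'a pretype \<Rightarrow> 'a pretype \<Rightarrow> bool" where
  teq_refl: "type_eq U U"
| teq_sym: "type_eq U V \<Longrightarrow> type_eq V U"
| teq_trans: "type_eq U V \<Longrightarrow> type_eq V W \<Longrightarrow> type_eq U W"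
| teq_arr: "type_eq U U' \<Longrightarrow> type_eq T T' \<Longrightarrow> type_eq (PArr U T) (PArr U' T')"
| teq_inter: "type_eq U U' \<Longrightarrow> type_eq V V' \<Longrightarrow> type_eq (PInter U V) (PInter U' V')"
| teq_exp: "type_eq U U' \<Longrightarrow> type_eq (PExp i U) (PExp i U')"
| teq_comm: "ptdeg U = ptdeg V \<Longrightarrow> type_eq (PInter U V) (PInter V U)"
| teq_assoc: "ptdeg U = ptdeg V \<Longrightarrow> ptdeg V = ptdeg W \<Longrightarrow>
    type_eq (PInter (PInter U V) W) (PInter U (PInter V W))"
| teq_idem: "type_eq (PInter U U) U"
| teq_exp_inter: "ptdeg U = ptdeg V \<Longrightarrow>
    type_eq (PExp i (PInter U V)) (PInter (PExp i U) (PExp i V))"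
| teq_omega: "ptdeg U = L \<Longrightarrow> type_eq (PInter (POmega L) U) U"
| teq_exp_omega: "type_eq (PExp i (POmega K)) (POmega (i # K))"

text \<open>\<open>U\<^sup>-\<^sup>K\<close> is meant for \<open>K \<preceq> d(U)\<close>. To be total and compatible with the equations, the operation
  in general removes the longest common prefix of \<open>K\<close> and the degree.\<close>

fun strip :: "idx \<Rightarrow> idx \<Rightarrow> idx" where
  "strip (i # K) (j # L) = (if i = j then strip K L else j # L)"
| "strip _ L = L"

primrec ptminus :: "'a pretype \<Rightarrow> idx \<Rightarrow> 'a pretype" where
  "ptminus (PAtom a) K = PAtom a"
| "ptminus (PArr U T) K = PArr U T"
| "ptminus (POmega L) K = POmega (strip K L)"
| "ptminus (PInter U V) K = PInter (ptminus U K) (ptminus V K)"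
| "ptminus (PExp i U) K =
    (case K of [] \<Rightarrow> PExp i U | j # K' \<Rightarrow> if i = j then ptminus U K' else PExp i U)"

lemma strip_Nil [simp]: "strip K [] = []"
  by (cases K) auto

lemma strip_append [simp]: "strip K (K @ L) = L"
  by (induction K) auto

lemma ptminus_Nil [simp]: "ptminus U [] = U"
  by (induction U) auto

lemma ptdeg_ptminus: "ptdeg (ptminus U K) = strip K (ptdeg U)"
  by (induction U arbitrary: K) (auto split: list.split)

lemma type_eq_ptdeg: "type_eq U V \<Longrightarrow> ptdeg U = ptdeg V"
  by (induction rule: type_eq.induct) auto

lemma type_eq_ptminus: "type_eq U V \<Longrightarrow> type_eq (ptminus U K) (ptminus V K)"
  by (induction arbitrary: K rule: type_eq.induct)
    (auto intro: type_eq.intros simp: ptdeg_ptminus split: list.split)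

quotient_type 'a ty = "'a pretype" / type_eq
  by (intro equivpI reflpI sympI transpI) (auto intro: type_eq.intros)

lift_definition Atom :: "'a \<Rightarrow> 'a ty" is PAtom .
lift_definition Arr :: "'a ty \<Rightarrow> 'a ty \<Rightarrow> 'a ty" is PArr by (rule teq_arr)
lift_definition Omega :: "idx \<Rightarrow> 'a ty" is POmega .
lift_definition Meet :: "'a ty \<Rightarrow> 'a ty \<Rightarrow> 'a ty" is PInter by (rule teq_inter)
lift_definition Exp :: "nat \<Rightarrow> 'a ty \<Rightarrow> 'a ty" is PExp by (rule teq_exp)
lift_definition tdeg :: "'a ty \<Rightarrow> idx" is ptdeg by (rule type_eq_ptdeg)
lift_definition tminus :: "idx \<Rightarrow> 'a ty \<Rightarrow> 'a ty" is "\<lambda>K U. ptminus U K" by (rule type_eq_ptminus)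

inductive_set \<T> :: "'a ty set" and \<U> :: "'a ty set" where
  T_Atom: "Atom a \<in> \<T>"
| T_Arr: "U \<in> \<U> \<Longrightarrow> T \<in> \<T> \<Longrightarrow> Arr U T \<in> \<T>"
| U_T: "T \<in> \<T> \<Longrightarrow> T \<in> \<U>"
| U_Omega: "Omega L \<in> \<U>"
| U_Inter: "U1 \<in> \<U> \<Longrightarrow> U2 \<in> \<U> \<Longrightarrow> tdeg U1 = tdeg U2 \<Longrightarrow> Meet U1 U2 \<in> \<U>"
| U_Exp: "U \<in> \<U> \<Longrightarrow> Exp i U \<in> \<U>"

lemma tdeg_simps [simp]:
  "tdeg (Atom a) = []" "tdeg (Arr U T) = []" "tdeg (Omega L) = L"
  "tdeg (Meet U V) = tdeg U" "tdeg (Exp i U) = i # tdeg U"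
  by (transfer; simp)+

lemma tminus_simps [simp]:
  "tminus [] U = U"
  "tminus K (Meet U V) = Meet (tminus K U) (tminus K V)"
  "tminus (i # K) (Exp i U) = tminus K U"
  "tminus K (Omega (K @ L)) = Omega L"
  by (transfer; simp add: teq_refl)+

subsection \<open>Environments\<close>

type_synonym 'a env = "ivar \<Rightarrow> 'a ty option"

definition Env :: "'a env set" where
  "Env = {\<Gamma>. finite (dom \<Gamma>) \<and> ran \<Gamma> \<subseteq> \<U>}"

definition env_omega :: "trm \<Rightarrow> 'a env" where
  "env_omega M = (\<lambda>(x, L). if (x, L) \<in> fv M then Some (Omega L) else None)"

definition OK :: "'a env \<Rightarrow> bool" where
  "OK \<Gamma> \<longleftrightarrow> (\<forall>x L U. \<Gamma> (x, L) = Some U \<longrightarrow> tdeg U = L)"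

definition env_inter :: "'a env \<Rightarrow> 'a env \<Rightarrow> 'a env" where
  "env_inter \<Gamma>1 \<Gamma>2 = (\<lambda>v. case (\<Gamma>1 v, \<Gamma>2 v) of
      (Some U1, Some U2) \<Rightarrow> Some (Meet U1 U2)
    | (Some U1, None) \<Rightarrow> Some U1
    | (None, W) \<Rightarrow> W)"

definition env_exp :: "nat \<Rightarrow> 'a env \<Rightarrow> 'a env" where
  "env_exp j \<Gamma> = (\<lambda>(x, K). case K of
      [] \<Rightarrow> None
    | i # L \<Rightarrow> if i = j then map_option (Exp j) (\<Gamma> (x, L)) else None)"

definition env_joinable :: "'a env \<Rightarrow> 'a env \<Rightarrow> bool" where
  "env_joinable \<Gamma>1 \<Gamma>2 \<longleftrightarrow> (\<forall>x L K. (x, L) \<in> dom \<Gamma>1 \<longrightarrow> (x, K) \<in> dom \<Gamma>2 \<longrightarrow> L = K)"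

text \<open>This is \<open>d(\<Gamma>) \<succeq> L\<close>.\<close>

definition env_deg_ge :: "'a env \<Rightarrow> idx \<Rightarrow> bool" where
  "env_deg_ge \<Gamma> L \<longleftrightarrow> (\<forall>x K U. \<Gamma> (x, K) = Some U \<longrightarrow> prefix L (tdeg U) \<and> prefix L K)"

definition env_minus :: "idx \<Rightarrow> 'a env \<Rightarrow> 'a env" where
  "env_minus L \<Gamma> = (\<lambda>(x, K). map_option (tminus L) (\<Gamma> (x, L @ K)))"

subsection \<open>Subtyping\<close>

inductive sub_ty :: "'a ty \<Rightarrow> 'a ty \<Rightarrow> bool" where
  st_refl: "U \<in> \<U> \<Longrightarrow> sub_ty U U"
| st_trans: "sub_ty U V \<Longrightarrow> sub_ty V W \<Longrightarrow> sub_ty U W"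
| st_interE: "U1 \<in> \<U> \<Longrightarrow> U2 \<in> \<U> \<Longrightarrow> tdeg U1 = tdeg U2 \<Longrightarrow> sub_ty (Meet U1 U2) U1"
| st_inter: "sub_ty U1 V1 \<Longrightarrow> sub_ty U2 V2 \<Longrightarrow> tdeg U1 = tdeg U2 \<Longrightarrow>
    sub_ty (Meet U1 U2) (Meet V1 V2)"
| st_arr: "sub_ty U2 U1 \<Longrightarrow> sub_ty T1 T2 \<Longrightarrow> T1 \<in> \<T> \<Longrightarrow> T2 \<in> \<T> \<Longrightarrow>
    sub_ty (Arr U1 T1) (Arr U2 T2)"
| st_exp: "sub_ty U1 U2 \<Longrightarrow> sub_ty (Exp i U1) (Exp i U2)"

inductive sub_env :: "'a env \<Rightarrow> 'a env \<Rightarrow> bool" where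
  se_refl: "\<Gamma> \<in> Env \<Longrightarrow> sub_env \<Gamma> \<Gamma>"
| se_trans: "sub_env \<Gamma>1 \<Gamma>2 \<Longrightarrow> sub_env \<Gamma>2 \<Gamma>3 \<Longrightarrow> sub_env \<Gamma>1 \<Gamma>3"
| se_upd: "\<Gamma> \<in> Env \<Longrightarrow> (y, L) \<notin> dom \<Gamma> \<Longrightarrow> sub_ty U1 U2 \<Longrightarrow>
    sub_env (\<Gamma>((y, L) \<mapsto> U1)) (\<Gamma>((y, L) \<mapsto> U2))"

text \<open>The pair \<open>(\<Gamma>, U)\<close> stands for \<open>\<langle>\<Gamma> \<turnstile> U\<rangle>\<close>.\<close>

inductive sub_typing :: "'a env \<times> 'a ty \<Rightarrow> 'a env \<times> 'a ty \<Rightarrow> bool" where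
  sy_refl: "\<Gamma> \<in> Env \<Longrightarrow> U \<in> \<U> \<Longrightarrow> sub_typing (\<Gamma>, U) (\<Gamma>, U)"
| sy_trans: "sub_typing \<Phi>1 \<Phi>2 \<Longrightarrow> sub_typing \<Phi>2 \<Phi>3 \<Longrightarrow> sub_typing \<Phi>1 \<Phi>3"
| sy_pair: "sub_ty U1 U2 \<Longrightarrow> sub_env \<Gamma>2 \<Gamma>1 \<Longrightarrow> sub_typing (\<Gamma>1, U1) (\<Gamma>2, U2)"

subsection \<open>Typing\<close>

text \<open>The relation lives on \<open>\<alpha>\<close>-classes of preterms, partial maps and classes of pretypes. Membership
  in \<open>\<M>\<close> and \<open>\<T>\<close> is required where a rule ranges over terms or over \<open>\<T>\<close>, but that the conclusion
  of a rule is again in \<open>\<M>\<close>, \<open>Env\<close> and \<open>\<U>\<close> (for instance, the degree and joinability conditions on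
  \<open>App M1 M2\<close> and the equality of degrees in \<open>Meet U1 U2\<close>) is not.\<close>

inductive typing :: "trm \<Rightarrow> 'a env \<Rightarrow> 'a ty \<Rightarrow> bool"
    (\<open>(_ :/ \<langle>_ \<turnstile> _\<rangle>)\<close> [51, 51, 51] 50) where
  ty_ax: "T \<in> \<T> \<Longrightarrow> Var (x, []) : \<langle>[(x, []) \<mapsto> T] \<turnstile> T\<rangle>"
| ty_omega: "M \<in> \<M> \<Longrightarrow> M : \<langle>env_omega M \<turnstile> Omega (deg M)\<rangle>"
| ty_arrI: "M : \<langle>\<Gamma>((x, L) \<mapsto> U) \<turnstile> T\<rangle> \<Longrightarrow> (x, L) \<notin> dom \<Gamma> \<Longrightarrow> T \<in> \<T> \<Longrightarrow>
    Lam (x, L) M : \<langle>\<Gamma> \<turnstile> Arr U T\<rangle>"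
| ty_arrI': "M : \<langle>\<Gamma> \<turnstile> T\<rangle> \<Longrightarrow> (x, L) \<notin> dom \<Gamma> \<Longrightarrow> T \<in> \<T> \<Longrightarrow>
    Lam (x, L) M : \<langle>\<Gamma> \<turnstile> Arr (Omega L) T\<rangle>"
| ty_arrE: "M1 : \<langle>\<Gamma>1 \<turnstile> Arr U T\<rangle> \<Longrightarrow> M2 : \<langle>\<Gamma>2 \<turnstile> U\<rangle> \<Longrightarrow> env_joinable \<Gamma>1 \<Gamma>2 \<Longrightarrow> T \<in> \<T> \<Longrightarrow>
    App M1 M2 : \<langle>env_inter \<Gamma>1 \<Gamma>2 \<turnstile> T\<rangle>"
| ty_interI: "M : \<langle>\<Gamma> \<turnstile> U1\<rangle> \<Longrightarrow> M : \<langle>\<Gamma> \<turnstile> U2\<rangle> \<Longrightarrow> M : \<langle>\<Gamma> \<turnstile> Meet U1 U2\<rangle>"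
| ty_exp: "M : \<langle>\<Gamma> \<turnstile> U\<rangle> \<Longrightarrow> lift j M : \<langle>env_exp j \<Gamma> \<turnstile> Exp j U\<rangle>"
| ty_sub: "M : \<langle>\<Gamma> \<turnstile> U\<rangle> \<Longrightarrow> sub_typing (\<Gamma>, U) (\<Gamma>', U') \<Longrightarrow> M : \<langle>\<Gamma>' \<turnstile> U'\<rangle>"

end

theory Submission
  imports Defs
begin

text \<open>The invariants of (1) and (2) are proved in one induction on the typing derivation, strengthened
  by \<open>dom \<Gamma> = fv M\<close>, which turns joinability of environments into joinability of terms. For (3), the
  rules whose conclusion is a type in \<open>\<T>\<close> only admit the empty index, subtyping is compatible with
  removing a common prefix, and removal undoes expansion. Rule \<open>\<omega>\<close> reduces to the latter because every
  term whose degree starts with \<open>i\<close> is the lifting by \<open>i\<close> of a term.\<close>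

subsection \<open>Lifting\<close>

lemma deg_lift [simp]: "deg (lift i M) = i # deg M"
proof transfer
  show "pdeg (plift i M) = i # pdeg M" for i M by (induction M) auto
qed

lemma pfv_plift: "pfv (plift i M) = (\<lambda>(x, L). (x, i # L)) ` pfv M"
  by (induction M) (auto simp: image_iff)

lemma fv_lift: "fv (lift i M) = (\<lambda>(x, L). (x, i # L)) ` fv M"
  by transfer (rule pfv_plift)

text \<open>Prepending \<open>i\<close> is injective on indices, so it creates and destroys no
  clash. The direction from unlifted to lifted terms serves \<open>lift_in_M\<close>, the converse
  serves \<open>M_eq_lift\<close>.\<close>

lemma joinable_lift [simp]: "joinable (lift i M) (lift i N) \<longleftrightarrow> joinable M N"
  by (fastforce simp: joinable_def fv_lift)

lemma lift_in_M: "M \<in> \<M> \<Longrightarrow> lift i M \<in> \<M>"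
  by (induction rule: \<M>.induct) (auto intro: \<M>.intros)

lemma pexpanded_by_plift: "pexpanded_by i (plift i M)"
  by (induction M) auto

lemma pdrop_plift: "pdrop (plift i M) = M"
  by (induction M) auto

text \<open>On preterms this is an actual equality: lifting makes every index start with
  \<open>i\<close>, binders included, so \<open>pminus\<close> takes its \<open>pdrop\<close> branch
  and never the default.\<close>

lemma term_minus1_lift [simp]: "term_minus1 i (lift i M) = M"
  by transfer (simp add: pminus_def pexpanded_by_plift pdrop_plift alpha_refl)

text \<open>The leading \<open>i\<close> of the degree spreads through the whole term, since the
  degree of a function is a prefix of that of its argument, and the degree of a body is a prefix of
  the binder index. Undoing the lift on the pieces preserves the side conditions of
  \<open>\<M>\<close>.\<close>

lemma M_eq_lift:
  "M \<in> \<M> \<Longrightarrow> prefix [i] (deg M) \<Longrightarrow> \<exists>N \<in> \<M>. M = lift i N"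
proof (induction rule: \<M>.induct)
  case (M_Var x L)
  then obtain L' where "L = i # L'" by (auto simp: prefix_def)
  then show ?case using \<M>.M_Var[of x L'] by force
next
  case (M_App M N)
  then have "prefix [i] (deg N)" using prefix_order.trans by fastforce
  with M_App obtain M' N' where MN: "M' \<in> \<M>" "N' \<in> \<M>" "M = lift i M'" "N = lift i N'"
    by auto
  then have "App M' N' \<in> \<M>" using M_App.hyps by (auto intro: \<M>.M_App)
  then show ?case using MN by force
next
  case (M_Lam M L x)
  then obtain M' where M': "M' \<in> \<M>" "M = lift i M'" by auto
  with M_Lam obtain L' where L': "L = i # L'" by (auto simp: prefix_def)
  then have "Lam (x, L') M' \<in> \<M>" using M' M_Lam by (auto intro: \<M>.M_Lam)
  then show ?case using M' L' by force
qed

text \<open>This supplies both prefix conditions of \<open>env_deg_ge\<close> for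
  \<open>env_omega M\<close>, where the type \<open>Omega L\<close> of a variable has the index
  \<open>L\<close> as its degree.\<close>

lemma deg_prefix_fv: "M \<in> \<M> \<Longrightarrow> (x, L) \<in> fv M \<Longrightarrow> prefix (deg M) L"
  by (induction arbitrary: x L rule: \<M>.induct) (auto intro: prefix_order.trans)

subsection \<open>Types and environments\<close>

lemma tdeg_T: "T \<in> \<T> \<Longrightarrow> tdeg T = []"
  by (erule \<T>.cases) auto

lemma Arr_in_U: "U \<in> \<U> \<Longrightarrow> T \<in> \<T> \<Longrightarrow> Arr U T \<in> \<U>"
  by (rule \<T>_\<U>.U_T[OF \<T>_\<U>.T_Arr])

lemma Exp_Omega: "Exp i (Omega L) = Omega (i # L)"
  by transfer (rule teq_exp_omega)

lemma tdeg_tminus: "tdeg (tminus K U) = strip K (tdeg U)"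
  by transfer (rule ptdeg_ptminus)

text \<open>The two sets are defined together, so the induction is simultaneous. The claim for
  \<open>\<T>\<close> may be trivial, since the degree of such a type is empty and forces
  \<open>K = []\<close>.\<close>

lemma tminus_in_U: "U \<in> \<U> \<Longrightarrow> prefix K (tdeg U) \<Longrightarrow> tminus K U \<in> \<U>"
proof -
  have "(T \<in> \<T> \<longrightarrow> True) \<and> (U \<in> \<U> \<longrightarrow> (\<forall>K. prefix K (tdeg U) \<longrightarrow> tminus K U \<in> \<U>))"
    for T U :: "'a ty"
  proof (induction rule: \<T>_\<U>.induct)
    case (U_T T)
    then show ?case by (auto simp: tdeg_T intro: \<T>_\<U>.U_T)
  next
    case (U_Omega L)
    then show ?case by (auto simp: prefix_def intro: \<T>_\<U>.U_Omega)
  next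
    case (U_Inter U1 U2)
    then show ?case by (auto simp: tdeg_tminus intro: \<T>_\<U>.U_Inter)
  next
    case (U_Exp U i)
    then show ?case by (auto simp: prefix_Cons intro: \<T>_\<U>.U_Exp)
  qed auto
  then show "U \<in> \<U> \<Longrightarrow> prefix K (tdeg U) \<Longrightarrow> tminus K U \<in> \<U>" by blast
qed

lemma EnvI:
  "finite (dom \<Gamma>) \<Longrightarrow> (\<And>v U. \<Gamma> v = Some U \<Longrightarrow> U \<in> \<U>) \<Longrightarrow> \<Gamma> \<in> Env"
  by (auto simp: Env_def ran_def)

lemma Env_finite_dom: "\<Gamma> \<in> Env \<Longrightarrow> finite (dom \<Gamma>)"
  by (simp add: Env_def)

lemma Env_in_U: "\<Gamma> \<in> Env \<Longrightarrow> \<Gamma> v = Some U \<Longrightarrow> U \<in> \<U>"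
  using ranI by (fastforce simp: Env_def)

lemma Env_upd: "\<Gamma> \<in> Env \<Longrightarrow> U \<in> \<U> \<Longrightarrow> \<Gamma>(v \<mapsto> U) \<in> Env"
  by (rule EnvI) (auto simp: Env_finite_dom intro: Env_in_U split: if_splits)

lemma env_minus_Nil [simp]: "env_minus [] \<Gamma> = \<Gamma>"
proof
  show "env_minus [] \<Gamma> v = \<Gamma> v" for v
    by (cases v; cases "\<Gamma> v") (simp_all add: env_minus_def)
qed

lemma env_minus_upd:
  "env_minus K (\<Gamma>((y, K @ L) \<mapsto> U)) = (env_minus K \<Gamma>)((y, L) \<mapsto> tminus K U)"
  by (auto simp: env_minus_def fun_eq_iff)

text \<open>The lookup at \<open>(i # K) @ L\<close> meets the entry that \<open>env_exp i\<close>
  moved there from \<open>K @ L\<close>, and \<open>tminus (i # K)\<close> cancels its outer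
  \<open>Exp i\<close>.\<close>

lemma env_minus_env_exp: "env_minus (i # K) (env_exp i \<Gamma>) = env_minus K \<Gamma>"
  by (auto simp: env_minus_def env_exp_def fun_eq_iff option.map_comp comp_def)

lemma env_minus_in_Env:
  assumes "\<Gamma> \<in> Env" "env_deg_ge \<Gamma> K"
  shows "env_minus K \<Gamma> \<in> Env"
proof (rule EnvI)
  \<comment> \<open>The domain is a preimage under the injection that prepends \<open>K\<close> to
    the index, hence finite.\<close>
  have "dom (env_minus K \<Gamma>) = (\<lambda>(x, L). (x, K @ L)) -` dom \<Gamma>"
    by (auto simp: env_minus_def)
  moreover have "inj (\<lambda>(x, L). (x :: nat, K @ L))" by (auto simp: inj_def)
  ultimately show "finite (dom (env_minus K \<Gamma>))"
    using Env_finite_dom[OF assms(1)] by (simp add: finite_vimageI)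
next
  fix v U assume "env_minus K \<Gamma> v = Some U"
  then show "U \<in> \<U>"
    using assms by (cases v) (auto simp: env_minus_def env_deg_ge_def intro: tminus_in_U Env_in_U)
qed

lemma dom_env_exp: "dom (env_exp i \<Gamma>) = (\<lambda>(x, L). (x, i # L)) ` dom \<Gamma>"
  by (force simp: env_exp_def dom_def split: list.splits if_splits)

lemma env_exp_eq_Some:
  "env_exp i \<Gamma> (x, K) = Some V \<longleftrightarrow> (\<exists>L U. K = i # L \<and> \<Gamma> (x, L) = Some U \<and> V = Exp i U)"
  by (auto simp: env_exp_def split: list.splits)

lemma env_exp_in_Env: "\<Gamma> \<in> Env \<Longrightarrow> env_exp i \<Gamma> \<in> Env"
  by (rule EnvI)
    (auto simp: dom_env_exp Env_finite_dom env_exp_eq_Some intro!: \<T>_\<U>.U_Exp intro: Env_in_U)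

lemma env_omega_lift: "env_omega (lift i M) = env_exp i (env_omega M)"
  by (force simp: env_omega_def env_exp_def fun_eq_iff fv_lift Exp_Omega split: list.splits)

lemma dom_env_omega: "dom (env_omega M) = fv M"
  by (auto simp: env_omega_def dom_def split: if_splits)

lemma env_omega_eq_Some: "env_omega M (x, L) = Some U \<longleftrightarrow> (x, L) \<in> fv M \<and> U = Omega L"
  by (auto simp: env_omega_def)

lemma env_omega_in_Env: "env_omega M \<in> Env"
  by (rule EnvI) (auto simp: dom_env_omega finite_fv env_omega_eq_Some intro: \<T>_\<U>.U_Omega)

lemma dom_env_inter: "dom (env_inter \<Gamma>1 \<Gamma>2) = dom \<Gamma>1 \<union> dom \<Gamma>2"
  by (auto simp: env_inter_def dom_def split: option.splits)

text \<open>\<open>OK\<close> forces both types of a common variable to have its index as degree,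
  which is what makes their \<open>Meet\<close> well formed.\<close>

lemma env_inter_in_Env:
  assumes "\<Gamma>1 \<in> Env" "\<Gamma>2 \<in> Env" "OK \<Gamma>1" "OK \<Gamma>2"
  shows "env_inter \<Gamma>1 \<Gamma>2 \<in> Env"
proof (rule EnvI)
  show "finite (dom (env_inter \<Gamma>1 \<Gamma>2))"
    using assms by (simp add: dom_env_inter Env_finite_dom)
next
  fix v U assume "env_inter \<Gamma>1 \<Gamma>2 v = Some U"
  then show "U \<in> \<U>"
    using assms
    by (cases v) (auto simp: env_inter_def OK_def split: option.splits
        intro: Env_in_U intro!: \<T>_\<U>.U_Inter)
qed

lemma OK_env_inter: "OK \<Gamma>1 \<Longrightarrow> OK \<Gamma>2 \<Longrightarrow> OK (env_inter \<Gamma>1 \<Gamma>2)"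
  by (auto simp: OK_def env_inter_def split: option.splits)

lemma env_deg_ge_Nil [simp]: "env_deg_ge \<Gamma> []"
  by (simp add: env_deg_ge_def)

subsection \<open>Subtyping\<close>

lemma sub_ty_invariants: "sub_ty U V \<Longrightarrow> U \<in> \<U> \<and> V \<in> \<U> \<and> tdeg U = tdeg V"
  by (induction rule: sub_ty.induct) (auto intro: \<T>_\<U>.intros)

text \<open>\<open>OK\<close> and \<open>env_deg_ge\<close> see only the domain and the degrees of
  the types, and subtyping changes neither. The equivalences let information flow against the
  direction of \<open>sub_env\<close>, as the contravariant subsumption rule requires.\<close>

lemma sub_env_invariants:
  "sub_env \<Gamma> \<Delta> \<Longrightarrow> \<Gamma> \<in> Env \<and> \<Delta> \<in> Env \<and> dom \<Gamma> = dom \<Delta> \<and> (OK \<Gamma> \<longleftrightarrow> OK \<Delta>) \<and>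
    (env_deg_ge \<Gamma> K \<longleftrightarrow> env_deg_ge \<Delta> K)"
proof (induction rule: sub_env.induct)
  case (se_upd \<Gamma> y L U1 U2)
  then have "U1 \<in> \<U>" "U2 \<in> \<U>" and deg: "tdeg U1 = tdeg U2"
    using sub_ty_invariants by auto
  then have "\<Gamma>((y, L) \<mapsto> U1) \<in> Env" "\<Gamma>((y, L) \<mapsto> U2) \<in> Env"
    using se_upd.hyps(1) by (simp_all add: Env_upd del: fun_upd_apply)
  moreover have "OK (\<Gamma>((y, L) \<mapsto> U1)) \<longleftrightarrow> OK (\<Gamma>((y, L) \<mapsto> U2))"
    "env_deg_ge (\<Gamma>((y, L) \<mapsto> U1)) K \<longleftrightarrow> env_deg_ge (\<Gamma>((y, L) \<mapsto> U2)) K"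
    using deg by (simp_all add: OK_def env_deg_ge_def)
  ultimately show ?case by (simp del: fun_upd_apply)
qed auto

text \<open>Inversion of \<open>sy_pair\<close>: the componentwise relation is itself reflexive and
  transitive, so closing under these two rules adds nothing.\<close>

lemma sub_typing_components:
  assumes "sub_typing (\<Gamma>, U) (\<Gamma>', U')"
  shows "sub_ty U U' \<and> sub_env \<Gamma>' \<Gamma>"
proof -
  have "sub_ty (snd \<Phi>) (snd \<Psi>) \<and> sub_env (fst \<Psi>) (fst \<Phi>)" if "sub_typing \<Phi> \<Psi>"
    for \<Phi> \<Psi> :: "'a env \<times> 'a ty"
    using that
    by (induction rule: sub_typing.induct) (auto intro: sub_ty.intros sub_env.intros)
  from this[OF assms] show ?thesis by simp
qed

text \<open>Arrows have empty degree, so only \<open>K = []\<close> arises there. Under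
  \<open>Exp i\<close>, either \<open>K\<close> is empty or it starts with \<open>i\<close> and the
  removal passes to the arguments; this is why \<open>K\<close> is generalised.\<close>

lemma sub_ty_tminus:
  "sub_ty U V \<Longrightarrow> prefix K (tdeg U) \<Longrightarrow> sub_ty (tminus K U) (tminus K V)"
proof (induction arbitrary: K rule: sub_ty.induct)
  case (st_refl U)
  then show ?case by (auto intro: sub_ty.st_refl tminus_in_U)
next
  case (st_trans U V W)
  then show ?case using sub_ty_invariants by (metis sub_ty.st_trans)
next
  case (st_interE U1 U2)
  then show ?case by (simp add: tdeg_tminus sub_ty.st_interE tminus_in_U)
next
  case (st_inter U1 V1 U2 V2)
  then show ?case by (auto simp: tdeg_tminus intro: sub_ty.st_inter)
next
  case (st_arr U2 U1 T1 T2)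
  then show ?case by (auto intro: sub_ty.st_arr)
next
  case (st_exp U1 U2 i)
  then show ?case by (auto simp: prefix_Cons intro: sub_ty.st_exp)
qed

lemma sub_env_env_minus:
  "sub_env \<Gamma> \<Delta> \<Longrightarrow> env_deg_ge \<Gamma> K \<Longrightarrow> sub_env (env_minus K \<Gamma>) (env_minus K \<Delta>)"
proof (induction rule: sub_env.induct)
  case (se_refl \<Gamma>)
  then show ?case by (auto intro: sub_env.se_refl env_minus_in_Env)
next
  case (se_trans \<Gamma>1 \<Gamma>2 \<Gamma>3)
  then show ?case using sub_env_invariants by (metis sub_env.se_trans)
next
  case (se_upd \<Gamma> y L U1 U2)
  then have pre: "prefix K (tdeg U1)" "prefix K L"
    by (auto simp: env_deg_ge_def split: if_splits)
  then obtain L' where L: "L = K @ L'" by (auto simp: prefix_def)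
  \<comment> \<open>As \<open>(y, L)\<close> is fresh for \<open>\<Gamma>\<close>, the update
    overwrites no entry, and \<open>\<Gamma>\<close> inherits the degree bound from its
    extension.\<close>
  have "(\<Gamma>((y, L) \<mapsto> U1)) v = Some V" if "\<Gamma> v = Some V" for v V
    using that se_upd.hyps(2) by auto
  then have "env_deg_ge \<Gamma> K"
    using se_upd.prems unfolding env_deg_ge_def by blast
  then have "env_minus K \<Gamma> \<in> Env" using se_upd.hyps by (simp add: env_minus_in_Env)
  moreover have "(y, L') \<notin> dom (env_minus K \<Gamma>)"
    using se_upd.hyps(2) L by (auto simp: env_minus_def)
  ultimately show ?case
    using se_upd.hyps(3) pre
    by (simp add: L env_minus_upd sub_env.se_upd sub_ty_tminus del: fun_upd_apply)
qed

subsection \<open>Typing\<close>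

lemma typing_invariants:
  "M : \<langle>\<Gamma> \<turnstile> U\<rangle> \<Longrightarrow> M \<in> \<M> \<and> \<Gamma> \<in> Env \<and> U \<in> \<U> \<and> OK \<Gamma> \<and> env_deg_ge \<Gamma> (tdeg U) \<and>
    tdeg U = deg M \<and> dom \<Gamma> = fv M"
proof (induction rule: typing.induct)
  case (ty_ax T x)
  then have "OK [(x, []) \<mapsto> T]" by (simp add: OK_def tdeg_T)
  with ty_ax show ?case
    by (simp add: tdeg_T \<M>.M_Var \<T>_\<U>.U_T Env_def del: fun_upd_apply)
next
  case (ty_omega M)
  then show ?case
    by (auto simp: OK_def env_deg_ge_def env_omega_eq_Some env_omega_in_Env dom_env_omega
        intro: \<T>_\<U>.U_Omega deg_prefix_fv)
next
  case (ty_arrI M \<Gamma> x L U T)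
  let ?\<Delta> = "\<Gamma>((x, L) \<mapsto> U)"
  \<comment> \<open>The body has a type in \<open>\<T>\<close>, hence empty degree, and so every
    \<open>L\<close> is an admissible binder index.\<close>
  have M: "M \<in> \<M>" "deg M = []" and \<Delta>: "?\<Delta> \<in> Env" "OK ?\<Delta>" "dom ?\<Delta> = fv M"
    using ty_arrI.IH tdeg_T[OF ty_arrI.hyps(3)] by (metis, metis, blast+)
  have sub: "?\<Delta> v = Some V" if "\<Gamma> v = Some V" for v V
    using that ty_arrI.hyps by auto
  have U: "U \<in> \<U>" by (rule Env_in_U[OF \<Delta>(1), of "(x, L)"]) simp
  have "insert (x, L) (dom \<Gamma>) = fv M" using \<Delta>(3) by (simp del: fun_upd_apply)
  then have dom: "dom \<Gamma> = fv M - {(x, L)}" using ty_arrI.hyps(2) by blast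
  have "\<Gamma> \<in> Env"
  proof (rule EnvI)
    show "finite (dom \<Gamma>)" by (simp add: dom finite_fv)
    show "V \<in> \<U>" if "\<Gamma> v = Some V" for v V by (rule Env_in_U[OF \<Delta>(1) sub[OF that]])
  qed
  moreover have "OK \<Gamma>" using sub \<Delta>(2) unfolding OK_def by blast
  moreover have "Lam (x, L) M \<in> \<M>" using M by (simp add: \<M>.M_Lam)
  ultimately show ?case using U M dom ty_arrI.hyps by (simp add: Arr_in_U)
next
  case (ty_arrI' M \<Gamma> T x L)
  then show ?case by (simp add: tdeg_T Arr_in_U \<T>_\<U>.U_Omega \<M>.M_Lam)
next
  case (ty_arrE M1 \<Gamma>1 U T M2 \<Gamma>2)
  \<comment> \<open>Here the domains of the environments are the sets of free variables. The degree
    condition on the application is immediate, because the arrow type gives \<open>M1\<close> the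
    empty degree.\<close>
  then have "joinable M1 M2" by (simp add: joinable_def env_joinable_def)
  then have "App M1 M2 \<in> \<M>" using ty_arrE.IH by (auto intro: \<M>.M_App)
  then show ?case using ty_arrE
    by (auto simp: tdeg_T env_inter_in_Env OK_env_inter dom_env_inter intro: \<T>_\<U>.U_T)
next
  case (ty_interI M \<Gamma> U1 U2)
  then show ?case by (auto intro: \<T>_\<U>.U_Inter)
next
  case (ty_exp M \<Gamma> U j)
  then show ?case
    by (auto simp: OK_def env_deg_ge_def env_exp_eq_Some env_exp_in_Env dom_env_exp fv_lift
        lift_in_M intro: \<T>_\<U>.U_Exp)
next
  case (ty_sub M \<Gamma> U \<Gamma>' U')
  then show ?case
    using sub_typing_components[OF ty_sub.hyps(2)] sub_ty_invariants[of U U']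
      sub_env_invariants[of \<Gamma>' \<Gamma> "tdeg U"] by auto
qed

text \<open>Each step of the induction on \<open>K\<close> peels one lift off the term, its
  environment and its type at once. \<open>Exp_Omega\<close> is used from right to left to expose
  the \<open>Exp i\<close> that the removal cancels.\<close>

lemma typing_term_minus_omega:
  "M \<in> \<M> \<Longrightarrow> prefix K (deg M) \<Longrightarrow>
    term_minus K M : \<langle>env_minus K (env_omega M) \<turnstile> tminus K (Omega (deg M))\<rangle>"
proof (induction K arbitrary: M)
  case Nil
  then show ?case by (simp add: ty_omega)
next
  case (Cons i K)
  then obtain N where N: "N \<in> \<M>" "M = lift i N"
    using M_eq_lift[of M i] by (auto simp: prefix_def)
  then show ?case
    using Cons.IH[of N] Cons.prems
    by (simp add: env_omega_lift env_minus_env_exp flip: Exp_Omega)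
qed

lemma typing_term_minus:
  "M : \<langle>\<Gamma> \<turnstile> U\<rangle> \<Longrightarrow> prefix K (tdeg U) \<Longrightarrow>
    term_minus K M : \<langle>env_minus K \<Gamma> \<turnstile> tminus K U\<rangle>"
proof (induction arbitrary: K rule: typing.induct)
  case (ty_ax T x)
  then show ?case by (simp add: tdeg_T typing.ty_ax del: fun_upd_apply)
next
  case (ty_omega M)
  then show ?case by (auto intro: typing_term_minus_omega)
next
  case (ty_arrI M \<Gamma> x L U T)
  then show ?case by (auto intro: typing.ty_arrI)
next
  case (ty_arrI' M \<Gamma> T x L)
  then show ?case by (auto intro: typing.ty_arrI')
next
  case (ty_arrE M1 \<Gamma>1 U T M2 \<Gamma>2)
  then show ?case by (auto simp: tdeg_T intro: typing.ty_arrE)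
next
  case (ty_interI M \<Gamma> U1 U2)
  \<comment> \<open>Both types have the degree of the common subject \<open>M\<close>, so
    \<open>K\<close> is a prefix of each and both induction hypotheses apply.\<close>
  then have "tdeg U1 = tdeg U2" using typing_invariants by metis
  then show ?case using ty_interI by (auto intro: typing.ty_interI)
next
  case (ty_exp M \<Gamma> U j)
  \<comment> \<open>For \<open>K = []\<close> the rule is applied again; for
    \<open>K = j # K'\<close> the removal of \<open>j\<close> cancels the expansion and leaves the
    induction hypothesis for \<open>K'\<close>.\<close>
  then show ?case by (auto simp: prefix_Cons env_minus_env_exp intro: typing.ty_exp)
next
  case (ty_sub M \<Gamma> U \<Gamma>' U')
  have sub: "sub_ty U U'" "sub_env \<Gamma>' \<Gamma>" using sub_typing_components[OF ty_sub.hyps(2)] by auto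
  then have K: "prefix K (tdeg U)" using ty_sub.prems sub_ty_invariants by metis
  \<comment> \<open>The invariant bounds \<open>\<Gamma>\<close> by \<open>tdeg U\<close>, hence by
    its prefix \<open>K\<close>; the bound then passes to \<open>\<Gamma>'\<close>, the smaller side
    of \<open>sub_env\<close>.\<close>
  have "env_deg_ge \<Gamma> K"
    using typing_invariants[OF ty_sub.hyps(1)] K
    by (auto simp: env_deg_ge_def intro: prefix_order.trans)
  then have "env_deg_ge \<Gamma>' K" using sub_env_invariants[OF sub(2)] by blast
  then have "sub_typing (env_minus K \<Gamma>, tminus K U) (env_minus K \<Gamma>', tminus K U')"
    using sub K by (intro sy_pair sub_ty_tminus sub_env_env_minus)
  then show ?case using ty_sub.IH[OF K] typing.ty_sub by blast
qed

theorem theorem3: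
  fixes M :: trm and \<Gamma> :: "'a env" and U :: "'a ty"
  assumes "M : \<langle>\<Gamma> \<turnstile> U\<rangle>"
  shows "(M \<in> \<M> \<and> \<Gamma> \<in> Env \<and> U \<in> \<U>) \<and>
         (OK \<Gamma> \<and> env_deg_ge \<Gamma> (tdeg U) \<and> tdeg U = deg M) \<and>
         (\<forall>K. prefix K (tdeg U) \<longrightarrow> term_minus K M : \<langle>env_minus K \<Gamma> \<turnstile> tminus K U\<rangle>)"
  using typing_invariants[OF assms] typing_term_minus[OF assms] by blast

end
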